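(* There exists a smooth Riemannian metric $g$ on the closed four-dimensional ball $B^4$ such that: (1) the boundary $\partial B^4$ is strictly convex with respect to $g$; (2) there exists a complete nonconstant $g$-geodesic $c:\mathbb{R}\to B^4$; (3) there does not exist a closed $g$-geodesic in $B^4$.
   Context: The boundary is strictly convex if its second fundamental form with respect to the inward pointing unit normal $\nu$, i.e. $h(v,w)=-g(\nabla_v\nu,w)$, is positive definite at every boundary point. A closed geodesic is a nonconstant periodic geodesic. A complete geodesic is one defined on all of $\mathbb{R}$. *)

theory Defs
  imports "HOL-Analysis.Analysis" "HOL-Library.Numeral_Type"
begin

primrec Ck_on :: "nat \<Rightarrow> ('a::euclidean_space \<Rightarrow> 'b::real_normed_vector) \<Rightarrow> 'a set \<Rightarrow> bool" where
  "Ck_on 0 = (\<lambda>f U. continuous_on U f)"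
| "Ck_on (Suc k) = (\<lambda>f U. (\<forall>x\<in>U. f differentiable (at x)) \<and>
     (\<forall>v. Ck_on k (\<lambda>x. frechet_derivative f (at x) v) U))"

(* Smoothness up to the boundary on a set that need not be open: there is a smooth extension
   to an open neighbourhood. *)
definition smooth_on :: "('a::euclidean_space \<Rightarrow> 'b::real_normed_vector) \<Rightarrow> 'a set \<Rightarrow> bool" where
  "smooth_on f S \<longleftrightarrow>
     (\<exists>U F. open U \<and> S \<subseteq> U \<and> (\<forall>k. Ck_on k F U) \<and> (\<forall>x\<in>S. F x = f x))"

(* A metric on a domain S of R^n is given by its matrix g x in the standard global coordinates,
   g x $ i $ j being the value of the metric on the i-th and j-th coordinate vector fields. *)
definition metric_form :: "(real^'n \<Rightarrow> real^'n^'n) \<Rightarrow> real^'n \<Rightarrow> real^'n \<Rightarrow> real^'n \<Rightarrow> real" where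
  "metric_form g x v w = v \<bullet> (g x *v w)"

definition riemannian_metric_on :: "(real^'n) set \<Rightarrow> (real^'n \<Rightarrow> real^'n^'n) \<Rightarrow> bool" where
  "riemannian_metric_on S g \<longleftrightarrow>
     smooth_on g S \<and>
     (\<forall>x\<in>S. transpose (g x) = g x \<and> (\<forall>v. v \<noteq> 0 \<longrightarrow> metric_form g x v v > 0))"

(* Derivatives are taken within S, so that only the values of the metric on S matter. They are
   uniquely determined for S = cball 0 1, also at boundary points (one-sided derivatives). *)
definition metric_partial ::
  "(real^'n) set \<Rightarrow> (real^'n \<Rightarrow> real^'n^'n) \<Rightarrow> real^'n \<Rightarrow> 'n \<Rightarrow> 'n \<Rightarrow> 'n \<Rightarrow> real" where
  "metric_partial S g x k i j =
     frechet_derivative (\<lambda>y. g y $ i $ j) (at x within S) (axis k 1)"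

(* christoffel S g x k i j has the upper index k and the lower indices i, j. *)
definition christoffel ::
  "(real^'n) set \<Rightarrow> (real^'n \<Rightarrow> real^'n^'n) \<Rightarrow> real^'n \<Rightarrow> 'n \<Rightarrow> 'n \<Rightarrow> 'n \<Rightarrow> real" where
  "christoffel S g x k i j =
     (1/2) * (\<Sum>l\<in>UNIV. matrix_inv (g x) $ k $ l *
       (metric_partial S g x i j l + metric_partial S g x j i l - metric_partial S g x l i j))"

definition christoffel_form ::
  "(real^'n) set \<Rightarrow> (real^'n \<Rightarrow> real^'n^'n) \<Rightarrow> real^'n \<Rightarrow> real^'n \<Rightarrow> real^'n \<Rightarrow> real^'n" where
  "christoffel_form S g x v w =
     (\<chi> k. \<Sum>i\<in>UNIV. \<Sum>j\<in>UNIV. christoffel S g x k i j * v $ i * w $ j)"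

definition complete_geodesic ::
  "(real^'n) set \<Rightarrow> (real^'n \<Rightarrow> real^'n^'n) \<Rightarrow> (real \<Rightarrow> real^'n) \<Rightarrow> bool" where
  "complete_geodesic S g c \<longleftrightarrow>
     (\<forall>t. c t \<in> S) \<and>
     (\<exists>c'. \<forall>t. (c has_vector_derivative c' t) (at t) \<and>
        (c' has_vector_derivative - christoffel_form S g (c t) (c' t) (c' t)) (at t))"

definition closed_geodesic ::
  "(real^'n) set \<Rightarrow> (real^'n \<Rightarrow> real^'n^'n) \<Rightarrow> (real \<Rightarrow> real^'n) \<Rightarrow> bool" where
  "closed_geodesic S g c \<longleftrightarrow>
     complete_geodesic S g c \<and> \<not> c constant_on UNIV \<and> (\<exists>T>0. \<forall>t. c (t + T) = c t)"

(* The tangent space of the unit sphere at x consists of the v with v \<bullet> x = 0. *)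
definition inward_unit_normal :: "(real^'n \<Rightarrow> real^'n^'n) \<Rightarrow> real^'n \<Rightarrow> real^'n" where
  "inward_unit_normal g x =
     (THE n. metric_form g x n n = 1 \<and> (\<forall>w. w \<bullet> x = 0 \<longrightarrow> metric_form g x n w = 0) \<and> n \<bullet> x < 0)"

(* Covariant derivative of the normal field in a direction v tangent to the sphere. The normal
   field lives on the sphere only; it is extended to be constant along rays before it is
   differentiated, and in tangent directions the result does not depend on the extension. *)
definition nabla_normal :: "(real^'n \<Rightarrow> real^'n^'n) \<Rightarrow> real^'n \<Rightarrow> real^'n \<Rightarrow> real^'n" where
  "nabla_normal g x v =
     frechet_derivative (\<lambda>y. inward_unit_normal g (sgn y)) (at x) v
       + christoffel_form (cball 0 1) g x v (inward_unit_normal g x)"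

definition second_fundamental_form ::
  "(real^'n \<Rightarrow> real^'n^'n) \<Rightarrow> real^'n \<Rightarrow> real^'n \<Rightarrow> real^'n \<Rightarrow> real" where
  "second_fundamental_form g x v w = - metric_form g x (nabla_normal g x v) w"

definition strictly_convex_boundary :: "(real^'n \<Rightarrow> real^'n^'n) \<Rightarrow> bool" where
  "strictly_convex_boundary g \<longleftrightarrow>
     (\<forall>x\<in>sphere 0 1. \<forall>v. v \<bullet> x = 0 \<and> v \<noteq> 0 \<longrightarrow> second_fundamental_form g x v v > 0)"

end

theory Submission
  imports Defs
begin

text \<open>
  Identify \<open>\<real>\<^sup>4\<close> with \<open>\<complex>\<^sup>2\<close> and let \<open>J(z, w) = (i z, i \<surd>2 w)\<close>, \<open>N = |J x|\<^sup>2\<close>, \<open>q = |z|\<^sup>2 - |w|\<^sup>2\<close>. The metric is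
  \<open>g(v, v) = |v|\<^sup>2 - \<psi> (J x \<bullet> v)\<^sup>2\<close> with \<open>\<psi> = 1 - N/3 - q\<^sup>2\<close>; the field \<open>J x\<close> is Killing.
  The Hessian of \<open>|x|\<^sup>2/2\<close> is \<open>|v|\<^sup>2 - k (J x \<bullet> v)\<^sup>2\<close> with \<open>k N = 1 - (1 - N)\<^sup>2 - 4 q\<^sup>2 N \<le> 1\<close>. Hence
  \<open>|x|\<^sup>2/2\<close> is convex, and its Hessian degenerates only on the torus \<open>|z|\<^sup>2 = |w|\<^sup>2 = 1/3\<close>, in the
  direction \<open>J x\<close>. At the unit sphere, where the normal is \<open>- x\<close>, the Hessian is the second
  fundamental form. Along a closed geodesic the derivative of \<open>|x|\<^sup>2/2\<close> is monotone and periodic, so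
  the Hessian vanishes on the velocity; conservation of the Killing momentum then forces the geodesic to be an orbit
  of the flow of \<open>J\<close> on the torus, which has irrational slope. These orbits are indeed geodesics,
  because \<open>\<psi> N\<^sup>2 - N\<close> is critical along the torus.
\<close>

subsection \<open>Derivatives within convex sets and smoothness of polynomials\<close>

text \<open>Restricting to the segment from \<open>x\<close> to \<open>y\<close> shows that both
  derivatives agree on \<open>y - x\<close> for every \<open>y\<close> in \<open>S\<close>.
  Differences of such vectors fill a small ball, and linearity does the rest. This identifies the
  one-sided derivatives in \<open>metric_partial\<close> at boundary points of the ball.\<close>

lemma has_derivative_unique_within_convex:
  fixes f :: "'a::euclidean_space \<Rightarrow> 'b::real_normed_vector"
  assumes "convex S" "interior S \<noteq> {}" "x \<in> S"
    and D: "(f has_derivative D) (at x within S)" and E: "(f has_derivative E) (at x within S)"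
  shows "D = E"
proof -
  have toward: "D (y - x) = E (y - x)" if "y \<in> S" for y
  proof -
    let ?\<gamma> = "\<lambda>t::real. x + t *\<^sub>R (y - x)"
    have sub: "?\<gamma> ` {0..1} \<subseteq> S"
    proof clarify
      fix t :: real assume "t \<in> {0..1}"
      then have "(1 - t) *\<^sub>R x + t *\<^sub>R y \<in> S"
        using assms(1,3) that by (intro convexD) auto
      then show "?\<gamma> t \<in> S" by (simp add: algebra_simps)
    qed
    have \<gamma>: "(?\<gamma> has_derivative (\<lambda>t. t *\<^sub>R (y - x))) (at 0 within {0..1})"
      by (auto intro!: derivative_eq_intros)
    have along: "((\<lambda>t. f (?\<gamma> t)) has_derivative (\<lambda>t. F (t *\<^sub>R (y - x)))) (at 0 within {0..1})"
      if "(f has_derivative F) (at x within S)" for F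
    proof -
      have "(f has_derivative F) (at (?\<gamma> 0) within ?\<gamma> ` {0..1})"
        using has_derivative_subset[OF that sub] by simp
      from has_derivative_in_compose[OF \<gamma> this] show ?thesis by simp
    qed
    have "(\<lambda>t. D (t *\<^sub>R (y - x))) = (\<lambda>t. E (t *\<^sub>R (y - x)))"
      by (rule frechet_derivative_unique_within_closed_interval[of 0 1 0])
        (use along[OF D] along[OF E] in \<open>auto simp: cbox_interval\<close>)
    from fun_cong[OF this, of 1] show ?thesis by simp
  qed
  obtain z where "z \<in> interior S" using assms(2) by blast
  then obtain e where "e > 0" and e: "ball z e \<subseteq> S" by (auto simp: mem_interior)
  interpret D: bounded_linear D using D by (rule has_derivative_bounded_linear)
  interpret E: bounded_linear E using E by (rule has_derivative_bounded_linear)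
  show ?thesis
  proof
    fix w :: 'a
    \<comment> \<open>The factor \<open>d\<close> scales \<open>w\<close> into the ball of radius
      \<open>e\<close>; the summand 1 takes care of \<open>w = 0\<close>.\<close>
    define d where "d = e / (norm w + 1)"
    have "d > 0" using \<open>e > 0\<close> by (simp add: d_def add_nonneg_pos)
    have "d * norm w < d * (norm w + 1)" using \<open>d > 0\<close> by simp
    also have "\<dots> = e" by (simp add: d_def add_nonneg_eq_0_iff)
    finally have "z + d *\<^sub>R w \<in> S" using \<open>d > 0\<close> e by (auto simp: dist_norm)
    moreover have "z \<in> S" using \<open>e > 0\<close> e by auto
    ultimately have "D (z + d *\<^sub>R w - x) - D (z - x) = E (z + d *\<^sub>R w - x) - E (z - x)"
      by (simp add: toward)
    then have "d *\<^sub>R D w = d *\<^sub>R E w"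
      by (simp add: D.add D.diff D.scaleR E.add E.diff E.scaleR)
    then show "D w = E w" using \<open>d > 0\<close> by simp
  qed
qed

text \<open>Structural induction with the sum and product rules. The direction \<open>v\<close>
  stays fixed while the base point varies, as in the recursion of \<open>Ck_on\<close>.\<close>

lemma real_polynomial_function_derivative:
  assumes "real_polynomial_function p"
  obtains p' where "\<And>x. (p has_derivative p' x) (at x)"
    "\<And>v. real_polynomial_function (\<lambda>x. p' x v)"
proof -
  have "\<exists>p'. (\<forall>x. (p has_derivative p' x) (at x)) \<and> (\<forall>v. real_polynomial_function (\<lambda>x. p' x v))"
    using assms
  proof induction
    case (linear f)
    then show ?case
      by (intro exI[of _ "\<lambda>_. f"]) (auto intro: bounded_linear_imp_has_derivative)
  next
    case (const c)
    then show ?case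
      by (intro exI[of _ "\<lambda>_ _. 0"]) auto
  next
    case (add f g)
    then obtain f' g' where
      "\<forall>x. (f has_derivative f' x) (at x)" "\<forall>v. real_polynomial_function (\<lambda>x. f' x v)"
      "\<forall>x. (g has_derivative g' x) (at x)" "\<forall>v. real_polynomial_function (\<lambda>x. g' x v)"
      by blast
    then show ?case
      by (intro exI[of _ "\<lambda>x v. f' x v + g' x v"]) (auto intro: has_derivative_add)
  next
    case (mult f g)
    then obtain f' g' where
      "\<forall>x. (f has_derivative f' x) (at x)" "\<forall>v. real_polynomial_function (\<lambda>x. f' x v)"
      "\<forall>x. (g has_derivative g' x) (at x)" "\<forall>v. real_polynomial_function (\<lambda>x. g' x v)"
      by blast
    with mult.hyps show ?case
      by (intro exI[of _ "\<lambda>x v. f x * g' x v + f' x v * g x"])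
        (auto intro!: has_derivative_mult real_polynomial_function.intros(3,4))
  qed
  with that show thesis by blast
qed

text \<open>Closure of polynomial maps under directional derivatives is the induction step for
  \<open>Ck_on\<close>; it reduces to coordinate functions.\<close>

lemma polynomial_function_frechet_derivative:
  fixes f :: "'a::euclidean_space \<Rightarrow> 'b::euclidean_space"
  assumes "polynomial_function f"
  shows "polynomial_function (\<lambda>x. frechet_derivative f (at x) v)"
  unfolding polynomial_function_iff_Basis_inner
proof
  fix b :: 'b assume "b \<in> Basis"
  then have "real_polynomial_function (\<lambda>x. f x \<bullet> b)"
    using assms by (simp add: polynomial_function_iff_Basis_inner)
  then obtain p' where p': "\<And>x. ((\<lambda>x. f x \<bullet> b) has_derivative p' x) (at x)"
    "\<And>v. real_polynomial_function (\<lambda>x. p' x v)"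
    by (rule real_polynomial_function_derivative) auto
  have "(f has_derivative frechet_derivative f (at x)) (at x)" for x
    using assms by (simp add: differentiable_at_polynomial_function flip: frechet_derivative_works)
  then have "((\<lambda>x. f x \<bullet> b) has_derivative (\<lambda>v. frechet_derivative f (at x) v \<bullet> b)) (at x)" for x
    by (rule has_derivative_inner_left)
  from has_derivative_unique[OF this p'(1)]
  have "(\<lambda>x. frechet_derivative f (at x) v \<bullet> b) = (\<lambda>x. p' x v)" by metis
  then show "real_polynomial_function (\<lambda>x. frechet_derivative f (at x) v \<bullet> b)"
    by (simp add: p'(2))
qed

lemma Ck_on_polynomial_function:
  fixes f :: "'a::euclidean_space \<Rightarrow> 'b::euclidean_space"
  assumes "polynomial_function f"
  shows "Ck_on k f U"
  using assms
  by (induction k arbitrary: f)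
    (auto intro: continuous_on_polymonial_function differentiable_at_polynomial_function
      polynomial_function_frechet_derivative)

lemma smooth_on_polynomial_function:
  fixes f :: "'a::euclidean_space \<Rightarrow> 'b::euclidean_space"
  assumes "polynomial_function f"
  shows "smooth_on f S"
  unfolding smooth_on_def using Ck_on_polynomial_function[OF assms]
  by (intro exI[of _ UNIV] exI[of _ f]) auto

subsection \<open>The Koszul formula\<close>

text \<open>Pairing with the metric cancels the inverse matrix in the Christoffel symbols, so that
  no inverse ever has to be computed. The vectors are constant in coordinates, hence the Lie bracket
  terms of the general Koszul formula are absent.\<close>

lemma metric_form_christoffel:
  fixes g :: "real^'n \<Rightarrow> real^'n^'n"
  assumes S: "convex S" "interior S \<noteq> {}" "x \<in> S"
    and inv: "invertible (g x)"
    and sym': "\<And>u. transpose (g' u) = g' u"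
    and der: "(g has_derivative g') (at x within S)"
  shows "2 * metric_form g x w (christoffel_form S g x v u) =
    w \<bullet> (g' v *v u) + w \<bullet> (g' u *v v) - v \<bullet> (g' w *v u)"
proof -
  have lin: "linear g'" using der by (rule has_derivative_linear)
  have mp: "metric_partial S g x k i j = g' (axis k 1) $ i $ j" for k i j
  proof -
    have "((\<lambda>y. g y $ i $ j) has_derivative (\<lambda>u. g' u $ i $ j)) (at x within S)"
      by (intro bounded_linear.has_derivative[OF bounded_linear_vec_nth] der)
    moreover from this have "((\<lambda>y. g y $ i $ j) has_derivative
        frechet_derivative (\<lambda>y. g y $ i $ j) (at x within S)) (at x within S)"
      by (meson differentiableI frechet_derivative_works)
    ultimately show ?thesis
      unfolding metric_partial_def
      using has_derivative_unique_within_convex[OF S] by metis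
  qed
  have g'_sum: "g' u $ i $ j = (\<Sum>k\<in>UNIV. u $ k * g' (axis k 1) $ i $ j)" for u i j
  proof -
    have "g' u = g' (\<Sum>k\<in>UNIV. u $ k *\<^sub>R axis k 1)"
      using basis_expansion[of u] by (simp add: scalar_mult_eq_scaleR)
    also have "\<dots> = (\<Sum>k\<in>UNIV. u $ k *\<^sub>R g' (axis k 1))"
      by (simp add: linear_sum[OF lin] linear_cmul[OF lin])
    finally show ?thesis by simp
  qed
  \<comment> \<open>The vector \<open>c i j\<close> collects the Christoffel symbols of the first
    kind, indexed by the lowered index \<open>l\<close>.\<close>
  define c where "c i j = (\<chi> l. (g' (axis i 1) $ j $ l + g' (axis j 1) $ i $ l - g' (axis l 1) $ i $ j) / 2)" for i j
  have "christoffel S g x k i j = (matrix_inv (g x) *v c i j) $ k" for k i j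
    unfolding christoffel_def mp c_def
    by (simp add: matrix_vector_mult_def sum_distrib_left mult_ac)
  moreover have inner_c: "2 * (w \<bullet> c i j) = (\<Sum>l\<in>UNIV. w $ l *
      (g' (axis i 1) $ j $ l + g' (axis j 1) $ i $ l - g' (axis l 1) $ i $ j))" for i j
    by (simp add: c_def inner_vec_def sum_distrib_left)
  ultimately have \<Gamma>: "christoffel_form S g x v u =
      matrix_inv (g x) *v (\<Sum>i\<in>UNIV. \<Sum>j\<in>UNIV. (v $ i * u $ j) *\<^sub>R c i j)"
    unfolding christoffel_form_def
    by (simp add: vec_eq_iff sum_component mult_ac linear_sum[OF matrix_vector_mul_linear] linear_cmul[OF matrix_vector_mul_linear])
  have trilinear: "b \<bullet> (g' a *v c) =
      (\<Sum>i\<in>UNIV. \<Sum>j\<in>UNIV. \<Sum>l\<in>UNIV. a $ i * b $ j * c $ l * g' (axis i 1) $ j $ l)" for a b c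
  proof -
    have "b \<bullet> (g' a *v c) =
        (\<Sum>j\<in>UNIV. \<Sum>l\<in>UNIV. \<Sum>i\<in>UNIV. a $ i * b $ j * c $ l * g' (axis i 1) $ j $ l)"
      by (simp add: inner_vec_def matrix_vector_mult_def g'_sum[of a] sum_distrib_left sum_distrib_right mult_ac)
    also have "\<dots> = (\<Sum>j\<in>UNIV. \<Sum>i\<in>UNIV. \<Sum>l\<in>UNIV. a $ i * b $ j * c $ l * g' (axis i 1) $ j $ l)"
      by (rule sum.cong[OF refl sum.swap])
    also have "\<dots> = (\<Sum>i\<in>UNIV. \<Sum>j\<in>UNIV. \<Sum>l\<in>UNIV. a $ i * b $ j * c $ l * g' (axis i 1) $ j $ l)"
      by (rule sum.swap)
    finally show ?thesis .
  qed
  have g'_swap: "b \<bullet> (g' a *v c) = c \<bullet> (g' a *v b)" for a b c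
    using sym'[of a] by (metis dot_lmul_matrix inner_commute transpose_matrix_vector)
  have first: "(\<Sum>i\<in>UNIV. \<Sum>j\<in>UNIV. \<Sum>l\<in>UNIV. v $ i * u $ j * w $ l * g' (axis i 1) $ j $ l) =
      w \<bullet> (g' v *v u)"
    by (subst g'_swap) (rule trilinear[symmetric])
  have second: "(\<Sum>i\<in>UNIV. \<Sum>j\<in>UNIV. \<Sum>l\<in>UNIV. v $ i * u $ j * w $ l * g' (axis j 1) $ i $ l) =
      w \<bullet> (g' u *v v)"
    by (subst g'_swap, subst trilinear, subst sum.swap) (simp only: mult_ac)
  have third: "(\<Sum>i\<in>UNIV. \<Sum>j\<in>UNIV. \<Sum>l\<in>UNIV. v $ i * u $ j * w $ l * g' (axis l 1) $ i $ j) =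
      v \<bullet> (g' w *v u)"
  proof -
    have "(\<Sum>i\<in>UNIV. \<Sum>j\<in>UNIV. \<Sum>l\<in>UNIV. v $ i * u $ j * w $ l * g' (axis l 1) $ i $ j) =
        (\<Sum>i\<in>UNIV. \<Sum>l\<in>UNIV. \<Sum>j\<in>UNIV. v $ i * u $ j * w $ l * g' (axis l 1) $ i $ j)"
      by (rule sum.cong[OF refl sum.swap])
    also have "\<dots> = v \<bullet> (g' w *v u)"
      by (subst sum.swap) (simp only: trilinear mult_ac)
    finally show ?thesis .
  qed
  have "g x ** matrix_inv (g x) = mat 1"
    using inv unfolding invertible_def matrix_inv_def by (metis (mono_tags, lifting) someI_ex)
  then have gi: "g x *v (matrix_inv (g x) *v y) = y" for y
    by (simp add: matrix_vector_mul_assoc)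
  have "2 * metric_form g x w (christoffel_form S g x v u) =
      (\<Sum>i\<in>UNIV. \<Sum>j\<in>UNIV. \<Sum>l\<in>UNIV. v $ i * u $ j * w $ l *
        (g' (axis i 1) $ j $ l + g' (axis j 1) $ i $ l - g' (axis l 1) $ i $ j))"
  proof -
    have "2 * metric_form g x w (christoffel_form S g x v u) =
        (\<Sum>i\<in>UNIV. \<Sum>j\<in>UNIV. v $ i * u $ j * (2 * (w \<bullet> c i j)))"
      unfolding metric_form_def \<Gamma> gi by (simp add: sum_distrib_left inner_sum_right mult_ac)
    also have "\<dots> = (\<Sum>i\<in>UNIV. \<Sum>j\<in>UNIV. \<Sum>l\<in>UNIV. v $ i * u $ j * w $ l *
        (g' (axis i 1) $ j $ l + g' (axis j 1) $ i $ l - g' (axis l 1) $ i $ j))"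
      by (simp only: inner_c sum_distrib_left mult.assoc)
    finally show ?thesis .
  qed
  also have "\<dots> = w \<bullet> (g' v *v u) + w \<bullet> (g' u *v v) - v \<bullet> (g' w *v u)"
    by (simp add: distrib_left right_diff_distrib sum.distrib sum_subtractf first second third)
  finally show ?thesis .
qed

subsection \<open>The metric\<close>

definition outer :: "real^'n \<Rightarrow> real^'m \<Rightarrow> real^'m^'n" where
  "outer a b = (\<chi> i j. a $ i * b $ j)"

lemma outer_component [simp]: "outer a b $ i $ j = a $ i * b $ j"
  by (simp add: outer_def)

lemma outer_mult_vec [simp]: "outer a b *v v = (b \<bullet> v) *\<^sub>R a"
  by (simp add: vec_eq_iff matrix_vector_mult_def inner_vec_def sum_distrib_left mult_ac)

lemma transpose_outer [simp]: "transpose (outer a b) = outer b a"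
  by (simp add: vec_eq_iff transpose_def)

lemma bounded_bilinear_outer: "bounded_bilinear outer"
  unfolding bilinear_conv_bounded_bilinear [symmetric] bilinear_def
  by (auto intro!: linearI simp: vec_eq_iff algebra_simps)

definition rotation :: "real^4 \<Rightarrow> real^4" where
  "rotation x = vector [- x $ 2, x $ 1, - (sqrt 2 * x $ 4), sqrt 2 * x $ 3]"

text \<open>The polarization of q; as a bilinear form it can be differentiated by the product
  rule.\<close>

definition split_form :: "real^4 \<Rightarrow> real^4 \<Rightarrow> real" where
  "split_form x y = x $ 1 * y $ 1 + x $ 2 * y $ 2 - x $ 3 * y $ 3 - x $ 4 * y $ 4"

definition profile :: "real^4 \<Rightarrow> real" where
  "profile x = 1 - rotation x \<bullet> rotation x / 3 - (split_form x x)\<^sup>2"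

definition trap_metric :: "real^4 \<Rightarrow> real^4^4" where
  "trap_metric x = mat 1 - profile x *\<^sub>R outer (rotation x) (rotation x)"

lemma rotation_component [simp]:
  "rotation x $ 1 = - x $ 2" "rotation x $ 2 = x $ 1"
  "rotation x $ 3 = - (sqrt 2 * x $ 4)" "rotation x $ 4 = sqrt 2 * x $ 3"
  by (simp_all add: rotation_def vector_def)

lemma inner_4: "x \<bullet> y = x $ 1 * y $ 1 + x $ 2 * y $ 2 + x $ 3 * y $ 3 + x $ 4 * y $ 4"
  for x y :: "real^4"
  by (simp add: inner_vec_def sum_4)

lemma inner_rotation_rotation:
  "rotation x \<bullet> rotation y = x $ 1 * y $ 1 + x $ 2 * y $ 2 + 2 * (x $ 3 * y $ 3 + x $ 4 * y $ 4)"
proof -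
  have "sqrt 2 * a * (sqrt 2 * b) = 2 * (a * b)" for a b :: real
    by simp
  then show ?thesis by (simp only: inner_4 rotation_component) simp
qed

lemma linear_rotation: "linear rotation"
  by (rule linearI) (auto simp: vec_eq_iff forall_4 algebra_simps)

lemma bounded_linear_rotation: "bounded_linear rotation"
  using linear_rotation by (simp add: linear_conv_bounded_linear)

lemma inner_rotation_left: "rotation x \<bullet> y = - (x \<bullet> rotation y)"
  by (simp add: inner_4)

lemma inner_rotation_self [simp]: "rotation x \<bullet> x = 0" "x \<bullet> rotation x = 0"
  by (simp_all add: inner_4)

lemma split_form_rotation_self [simp]: "split_form x (rotation x) = 0"
  by (simp add: split_form_def)

lemma bounded_bilinear_split_form: "bounded_bilinear split_form"
  unfolding bilinear_conv_bounded_bilinear [symmetric] bilinear_def split_form_def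
  by (auto intro!: linearI simp: algebra_simps)

lemma split_form_commute: "split_form x y = split_form y x"
  by (simp add: split_form_def)

definition profile' :: "real^4 \<Rightarrow> real^4 \<Rightarrow> real" where
  "profile' x u = - (2 / 3 * (rotation x \<bullet> rotation u)) - 4 * split_form x x * split_form x u"

lemma profile'_minus [simp]: "profile' x (- u) = - profile' x u"
  by (simp add: profile'_def split_form_def linear_neg[OF linear_rotation] algebra_simps)

lemma has_derivative_profile: "(profile has_derivative profile' x) (at x within S)"
  unfolding profile_def [abs_def] profile'_def
  by (auto intro!: derivative_eq_intros bounded_linear.has_derivative[OF bounded_linear_rotation]
      bounded_bilinear.FDERIV[OF bounded_bilinear_split_form]
    simp: inner_commute split_form_commute algebra_simps)

definition trap_metric' :: "real^4 \<Rightarrow> real^4 \<Rightarrow> real^4^4" where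
  "trap_metric' x u = (- profile' x u) *\<^sub>R outer (rotation x) (rotation x)
    - profile x *\<^sub>R (outer (rotation u) (rotation x) + outer (rotation x) (rotation u))"

lemma has_derivative_trap_metric: "(trap_metric has_derivative trap_metric' x) (at x within S)"
  unfolding trap_metric_def [abs_def] trap_metric'_def
  by (auto intro!: derivative_eq_intros bounded_linear.has_derivative[OF bounded_linear_rotation]
      bounded_bilinear.FDERIV[OF bounded_bilinear_outer] has_derivative_profile
    simp: algebra_simps)

lemma metric_form_trap_metric:
  "metric_form trap_metric x v w = v \<bullet> w - profile x * (rotation x \<bullet> v) * (rotation x \<bullet> w)"
  by (simp add: metric_form_def trap_metric_def matrix_vector_mult_diff_rdistrib
      inner_diff_right inner_commute flip: scaleR_matrix_vector_assoc)

lemma inner_trap_metric':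
  "v \<bullet> (trap_metric' x u *v w) = - profile' x u * (rotation x \<bullet> v) * (rotation x \<bullet> w)
    - profile x * ((rotation u \<bullet> v) * (rotation x \<bullet> w) + (rotation x \<bullet> v) * (rotation u \<bullet> w))"
  unfolding trap_metric'_def
  by (simp add: matrix_vector_mult_diff_rdistrib matrix_vector_mult_add_rdistrib inner_diff_right
      inner_add_right inner_commute algebra_simps del: scaleR_minus_left flip: scaleR_matrix_vector_assoc)

lemma inner_rotation_bound: "(rotation x \<bullet> v)\<^sup>2 \<le> (rotation x \<bullet> rotation x) * (v \<bullet> v)"
  by (rule Cauchy_Schwarz_ineq)

text \<open>Where \<open>rotation x\<close> is nonzero, 1 - \<psi> N is the eigenvalue of the metric
  in that direction, and the other eigenvalues are 1. Completing the square in 1 - N + N^2/3 + q^2 N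
  shows that it is positive.\<close>

lemma profile_bound: "profile x * (rotation x \<bullet> rotation x) < 1"
proof -
  define N where "N = rotation x \<bullet> rotation x"
  have "0 < (1 - N / 2)\<^sup>2 + N\<^sup>2 / 12"
    by (cases "N = 0") (auto intro: add_nonneg_pos)
  moreover have "0 \<le> (split_form x x)\<^sup>2 * N" by (simp add: N_def)
  moreover have "1 - profile x * N = (1 - N / 2)\<^sup>2 + N\<^sup>2 / 12 + (split_form x x)\<^sup>2 * N"
    unfolding profile_def N_def [symmetric] by (simp add: field_simps power2_eq_square)
  ultimately show ?thesis unfolding N_def [symmetric] by linarith
qed

lemma metric_form_trap_metric_pos:
  assumes "v \<noteq> 0"
  shows "0 < metric_form trap_metric x v v"
\<comment> \<open>A nonpositive profile only enlarges the Euclidean form; a positive one is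
  controlled by Cauchy-Schwarz and \<open>profile_bound\<close>.\<close>
proof (cases "profile x \<le> 0")
  case True
  have "profile x * (rotation x \<bullet> v)\<^sup>2 \<le> 0"
    using True by (simp add: mult_nonpos_nonneg)
  moreover have "0 < v \<bullet> v" using assms by simp
  ultimately show ?thesis
    unfolding metric_form_trap_metric power2_eq_square mult.assoc by linarith
next
  case False
  have "profile x * (rotation x \<bullet> v)\<^sup>2 \<le> profile x * ((rotation x \<bullet> rotation x) * (v \<bullet> v))"
    using False inner_rotation_bound by (intro mult_left_mono) auto
  also have "\<dots> < v \<bullet> v"
    using mult_strict_right_mono[OF profile_bound[of x], of "v \<bullet> v"] assms by (simp add: mult.assoc)
  finally show ?thesis
    unfolding metric_form_trap_metric by (simp add: power2_eq_square mult.assoc)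
qed

lemma transpose_trap_metric [simp]: "transpose (trap_metric x) = trap_metric x"
  by (simp add: vec_eq_iff transpose_def trap_metric_def mat_def mult_ac)

lemma transpose_trap_metric' [simp]: "transpose (trap_metric' x u) = trap_metric' x u"
  by (simp add: vec_eq_iff transpose_def trap_metric'_def algebra_simps)

lemma invertible_trap_metric: "invertible (trap_metric x)"
  unfolding invertible_left_inverse matrix_left_invertible_ker
  using metric_form_trap_metric_pos[of _ x] by (fastforce simp: metric_form_def)

text \<open>The entries of the matrix are polynomials in the coordinates, so the metric is smooth on
  the whole space.\<close>

lemma riemannian_metric_on_trap_metric: "riemannian_metric_on S trap_metric"
proof -
  have "real_polynomial_function (\<lambda>x. trap_metric x $ i $ j)" for i j
  proof -
    have lin: "bounded_linear (\<lambda>x. rotation x $ k)" for k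
      by (rule bounded_linear_compose[OF bounded_linear_vec_nth bounded_linear_rotation])
    have vec: "bounded_linear (\<lambda>x::real^4. x $ k)" for k
      by (rule bounded_linear_vec_nth)
    have prof: "real_polynomial_function profile"
      unfolding profile_def [abs_def] inner_vec_def split_form_def
      by (intro real_polynomial_function_diff real_polynomial_function.intros(2-4)
          real_polynomial_function_power real_polynomial_function_divide real_polynomial_function_sum)
        (auto intro!: real_polynomial_function.intros(3,4) real_polynomial_function.intros(1)[OF lin] real_polynomial_function.intros(1)[OF vec])
    show ?thesis
      unfolding trap_metric_def
      by (auto intro!: real_polynomial_function_diff real_polynomial_function.intros(2,4)
          real_polynomial_function.intros(1)[OF lin] prof)
  qed
  then have "polynomial_function trap_metric"
    by (auto simp: polynomial_function_iff_Basis_inner Basis_vec_def inner_axis)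
  then show ?thesis
    by (simp add: riemannian_metric_on_def smooth_on_polynomial_function metric_form_trap_metric_pos)
qed

subsection \<open>Convexity of the squared radius\<close>

abbreviation \<Gamma> :: "real^4 \<Rightarrow> real^4 \<Rightarrow> real^4 \<Rightarrow> real^4" where
  "\<Gamma> \<equiv> christoffel_form (cball 0 1) trap_metric"

lemma metric_form_\<Gamma>:
  assumes "norm x \<le> 1"
  shows "2 * metric_form trap_metric x w (\<Gamma> x v u) =
    w \<bullet> (trap_metric' x v *v u) + w \<bullet> (trap_metric' x u *v v) - v \<bullet> (trap_metric' x w *v u)"
  using assms
  by (intro metric_form_christoffel[OF _ _ _ invertible_trap_metric _ has_derivative_trap_metric])
    auto

text \<open>A closed form of the Riemannian Hessian of |x|^2/2 on the pair (v, v);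
  \<open>inner_\<Gamma>_radial\<close> justifies it.\<close>

definition radial_hessian :: "real^4 \<Rightarrow> real^4 \<Rightarrow> real" where
  "radial_hessian x v =
    v \<bullet> v - (2 - rotation x \<bullet> rotation x - 4 * (split_form x x)\<^sup>2) * (rotation x \<bullet> v)\<^sup>2"

lemma radial_profile': "2 * profile x + profile' x x / 2 =
    2 - rotation x \<bullet> rotation x - 4 * (split_form x x)\<^sup>2"
  by (simp add: profile_def profile'_def power2_eq_square field_simps)

text \<open>Since \<open>rotation x\<close> is orthogonal to \<open>x\<close>, the Euclidean and the
  Riemannian pairing with \<open>x\<close> coincide, and the Koszul formula applies. The coefficient
  2 \<psi> comes from differentiating \<open>rotation\<close>, the other part from the radial
  derivative of \<psi>.\<close>

lemma inner_\<Gamma>_radial: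
  assumes "norm x \<le> 1"
  shows "v \<bullet> v - x \<bullet> \<Gamma> x v v = radial_hessian x v"
proof -
  have "2 * (x \<bullet> \<Gamma> x v v) = 2 * metric_form trap_metric x x (\<Gamma> x v v)"
    by (simp add: metric_form_trap_metric)
  also have "\<dots> = 2 * (2 * profile x + profile' x x / 2) * (rotation x \<bullet> v)\<^sup>2"
    unfolding metric_form_\<Gamma>[OF assms] inner_trap_metric'
    by (simp add: inner_rotation_left[of v x] inner_commute[of v] algebra_simps power2_eq_square)
  finally show ?thesis
    unfolding radial_profile' radial_hessian_def by (simp add: algebra_simps)
qed

text \<open>Multiplication by N splits the Hessian into the Cauchy-Schwarz defect of
  \<open>rotation x\<close> and \<open>v\<close> and a multiple of a visibly nonnegative
  factor.\<close>

lemma radial_hessian_eq: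
  "(rotation x \<bullet> rotation x) * radial_hessian x v =
    ((rotation x \<bullet> rotation x) * (v \<bullet> v) - (rotation x \<bullet> v)\<^sup>2)
    + ((1 - rotation x \<bullet> rotation x)\<^sup>2 + 4 * (split_form x x)\<^sup>2 * (rotation x \<bullet> rotation x))
      * (rotation x \<bullet> v)\<^sup>2"
  by (simp add: radial_hessian_def power2_eq_square algebra_simps)

lemma radial_hessian_nonneg: "0 \<le> radial_hessian x v"
proof (cases "rotation x = 0")
  case False
  have "0 \<le> (rotation x \<bullet> rotation x) * radial_hessian x v"
    unfolding radial_hessian_eq using inner_rotation_bound[of x v] by simp
  moreover have "0 < rotation x \<bullet> rotation x" using False by simp
  ultimately show ?thesis by (simp only: zero_le_mult_iff) auto
qed (simp add: radial_hessian_def)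

text \<open>Both summands of \<open>radial_hessian_eq\<close> must vanish. The second one gives the
  torus, the first one is the equality case of Cauchy-Schwarz.\<close>

lemma radial_hessian_eq_0D:
  assumes "radial_hessian x v = 0" "v \<noteq> 0"
  shows "rotation x \<bullet> rotation x = 1" "split_form x x = 0" "v = (rotation x \<bullet> v) *\<^sub>R rotation x"
proof -
  define N where "N = rotation x \<bullet> rotation x"
  define s where "s = rotation x \<bullet> v"
  \<comment> \<open>If \<open>s\<close> were zero, the Hessian would be
    \<open>v \<bullet> v\<close>, which is positive.\<close>
  have "s \<noteq> 0" using assms by (auto simp: radial_hessian_def s_def)
  then have "N \<noteq> 0" by (auto simp: N_def s_def)
  have "N \<ge> 0" by (simp add: N_def)
  have cs: "0 \<le> N * (v \<bullet> v) - s\<^sup>2"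
    using inner_rotation_bound[of x v] by (simp add: N_def s_def)
  have sum0: "(N * (v \<bullet> v) - s\<^sup>2) + ((1 - N)\<^sup>2 + 4 * (split_form x x)\<^sup>2 * N) * s\<^sup>2 = 0"
    using radial_hessian_eq[of x v] assms(1) by (simp add: N_def s_def)
  have "0 \<le> ((1 - N)\<^sup>2 + 4 * (split_form x x)\<^sup>2 * N) * s\<^sup>2"
    using \<open>N \<ge> 0\<close> by simp
  with cs sum0 have eqs: "N * (v \<bullet> v) = s\<^sup>2" "((1 - N)\<^sup>2 + 4 * (split_form x x)\<^sup>2 * N) * s\<^sup>2 = 0"
    by linarith+
  with \<open>s \<noteq> 0\<close> have "(1 - N)\<^sup>2 + 4 * (split_form x x)\<^sup>2 * N = 0" by simp
  then have "(1 - N)\<^sup>2 = 0 \<and> 4 * (split_form x x)\<^sup>2 * N = 0"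
    using \<open>N \<ge> 0\<close> by (subst (asm) add_nonneg_eq_0_iff) auto
  then have N: "N = 1" and q: "split_form x x = 0"
    using \<open>N \<noteq> 0\<close> by auto
  have "(v - s *\<^sub>R rotation x) \<bullet> (v - s *\<^sub>R rotation x) = v \<bullet> v - 2 * s * s + s * s * N"
    by (simp add: N_def s_def inner_diff inner_commute algebra_simps)
  also have "\<dots> = 0" using eqs(1) N by (simp add: power2_eq_square)
  finally have "v = s *\<^sub>R rotation x" by simp
  with N q show "rotation x \<bullet> rotation x = 1" "split_form x x = 0"
    "v = (rotation x \<bullet> v) *\<^sub>R rotation x" by (simp_all add: N_def s_def)
qed

lemma clifford_torus_iff:
  "rotation x \<bullet> rotation x = 1 \<and> split_form x x = 0 \<longleftrightarrow>
    (x $ 1)\<^sup>2 + (x $ 2)\<^sup>2 = 1/3 \<and> (x $ 3)\<^sup>2 + (x $ 4)\<^sup>2 = 1/3"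
proof -
  have "a + 2 * b = 1 \<and> a - b = 0 \<longleftrightarrow> a = 1/3 \<and> b = 1/3" for a b :: real by auto
  from this[of "(x $ 1)\<^sup>2 + (x $ 2)\<^sup>2" "(x $ 3)\<^sup>2 + (x $ 4)\<^sup>2"] show ?thesis
    by (simp only: inner_rotation_rotation split_form_def power2_eq_square diff_diff_eq)
qed

lemma clifford_torus:
  assumes "rotation x \<bullet> rotation x = 1" "split_form x x = 0"
  shows "(x $ 1)\<^sup>2 + (x $ 2)\<^sup>2 = 1/3" "(x $ 3)\<^sup>2 + (x $ 4)\<^sup>2 = 1/3" "x \<bullet> x = 2/3"
proof -
  show torus: "(x $ 1)\<^sup>2 + (x $ 2)\<^sup>2 = 1/3" "(x $ 3)\<^sup>2 + (x $ 4)\<^sup>2 = 1/3"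
    using assms clifford_torus_iff[of x] by blast+
  have "x \<bullet> x = ((x $ 1)\<^sup>2 + (x $ 2)\<^sup>2) + ((x $ 3)\<^sup>2 + (x $ 4)\<^sup>2)"
    by (simp add: inner_4 power2_eq_square)
  then show "x \<bullet> x = 2/3" by (simp add: torus)
qed

subsection \<open>The boundary\<close>

text \<open>The correction term of the metric kills \<open>x\<close>, so lengths of \<open>x\<close>
  and orthogonality to \<open>x\<close> are Euclidean.\<close>

lemma inward_unit_normal_trap_metric:
  assumes "norm x = 1"
  shows "inward_unit_normal trap_metric x = - x"
  unfolding inward_unit_normal_def
proof (rule the_equality)
  have "x \<bullet> x = 1" using assms by (simp add: dot_square_norm)
  then show "metric_form trap_metric x (- x) (- x) = 1 \<and>
      (\<forall>w. w \<bullet> x = 0 \<longrightarrow> metric_form trap_metric x (- x) w = 0) \<and> - x \<bullet> x < 0"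
    by (simp add: metric_form_trap_metric inner_commute)
  fix n
  assume n: "metric_form trap_metric x n n = 1 \<and>
      (\<forall>w. w \<bullet> x = 0 \<longrightarrow> metric_form trap_metric x n w = 0) \<and> n \<bullet> x < 0"
  \<comment> \<open>The tangential part of \<open>n\<close> is orthogonal to \<open>n\<close> and to
    \<open>x\<close> for the metric, hence to itself.\<close>
  define m where "m = n - (n \<bullet> x) *\<^sub>R x"
  have "m \<bullet> x = 0" using \<open>x \<bullet> x = 1\<close> by (simp add: m_def inner_diff_left)
  then have "metric_form trap_metric x m m = 0"
    using n[THEN conjunct2, THEN conjunct1, rule_format, of m]
    by (simp add: metric_form_trap_metric m_def inner_diff_left inner_diff_right inner_commute algebra_simps)
  then have "m = 0" using metric_form_trap_metric_pos[of m x] by force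
  then have n_eq: "n = (n \<bullet> x) *\<^sub>R x" by (simp add: m_def)
  have "metric_form trap_metric x n n = (n \<bullet> x)\<^sup>2"
    by (subst n_eq, subst n_eq) (simp add: metric_form_trap_metric \<open>x \<bullet> x = 1\<close> power2_eq_square)
  with n have "n \<bullet> x = -1" by (auto simp: power2_eq_1_iff)
  with n_eq show "n = - x" by simp
qed

lemma strictly_convex_boundary_trap_metric: "strictly_convex_boundary trap_metric"
  unfolding strictly_convex_boundary_def
proof (intro ballI allI impI, elim conjE)
  fix x v :: "real^4"
  assume "x \<in> sphere 0 1" and v: "v \<bullet> x = 0" "v \<noteq> 0"
  then have x: "norm x = 1" by simp
  then have xx: "x \<bullet> x = 1" by (simp add: dot_square_norm)
  \<comment> \<open>The extension of the normal along rays is \<open>- sgn\<close>, whose derivative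
    at \<open>x\<close> is minus the projection to the tangent space.\<close>
  have "((\<lambda>y. - sgn y) has_derivative (\<lambda>h. - (h - (h \<bullet> x) *\<^sub>R x))) (at x)"
    unfolding sgn_div_norm
    using x by (auto intro!: derivative_eq_intros has_derivative_norm simp: sgn_div_norm inner_commute)
  then have "((\<lambda>y. inward_unit_normal trap_metric (sgn y)) has_derivative
      (\<lambda>h. - (h - (h \<bullet> x) *\<^sub>R x))) (at x)"
    using x by (elim has_derivative_transform_within_open[where s = "- {0}"])
      (auto simp: inward_unit_normal_trap_metric norm_sgn)
  then have "frechet_derivative (\<lambda>y. inward_unit_normal trap_metric (sgn y)) (at x) v = - v"
    using v by (simp flip: frechet_derivative_at)
  then have "second_fundamental_form trap_metric x v v =
      metric_form trap_metric x v v - metric_form trap_metric x v (\<Gamma> x v (- x))"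
    by (simp add: second_fundamental_form_def nabla_normal_def inward_unit_normal_trap_metric x
        metric_form_trap_metric inner_commute algebra_simps)
  \<comment> \<open>The first and third Koszul terms are identical and cancel.\<close>
  moreover have "2 * metric_form trap_metric x v (\<Gamma> x v (- x)) = - (v \<bullet> (trap_metric' x x *v v))"
    using x by (simp add: metric_form_\<Gamma> inner_trap_metric' linear_neg[OF linear_rotation]
        profile'_minus algebra_simps)
  ultimately have "second_fundamental_form trap_metric x v v =
      v \<bullet> v - (2 * profile x + profile' x x / 2) * (rotation x \<bullet> v)\<^sup>2"
    by (simp add: metric_form_trap_metric[of x v v] inner_trap_metric' field_simps power2_eq_square)
  then have "second_fundamental_form trap_metric x v v = radial_hessian x v"
    by (simp only: radial_profile' radial_hessian_def)
  \<comment> \<open>Degeneracy would place \<open>x\<close> on the torus, where |x|^2 is 2/3 and not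
    1.\<close>
  moreover have "radial_hessian x v \<noteq> 0"
  proof
    assume "radial_hessian x v = 0"
    from clifford_torus(3)[OF radial_hessian_eq_0D(1,2)[OF this v(2)]] xx
    show False by simp
  qed
  ultimately show "0 < second_fundamental_form trap_metric x v v"
    using radial_hessian_nonneg[of x v] by linarith
qed

subsection \<open>Geodesics\<close>

definition killing_momentum :: "real^4 \<Rightarrow> real^4 \<Rightarrow> real" where
  "killing_momentum x v = (rotation x \<bullet> v) * (1 - profile x * (rotation x \<bullet> rotation x))"

lemma metric_form_rotation: "metric_form trap_metric x (rotation x) v = killing_momentum x v"
  by (simp add: metric_form_trap_metric killing_momentum_def algebra_simps)

text \<open>Infinitesimal invariance of the profile under the flow of \<open>rotation\<close>, which
  makes that field Killing.\<close>

lemma profile'_rotation [simp]: "profile' x (rotation x) = 0"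
  by (simp add: profile'_def)

lemma killing_momentum_\<Gamma>:
  assumes "norm x \<le> 1"
  shows "killing_momentum x (\<Gamma> x v v) =
    (rotation x \<bullet> v) * (- profile' x v * (rotation x \<bullet> rotation x) - 2 * profile x * (rotation x \<bullet> rotation v))"
proof -
  have "2 * killing_momentum x (\<Gamma> x v v) =
    2 * ((rotation x \<bullet> v) * (- profile' x v * (rotation x \<bullet> rotation x) - 2 * profile x * (rotation x \<bullet> rotation v)))"
    unfolding metric_form_rotation [symmetric] metric_form_\<Gamma>[OF assms] inner_trap_metric'
    by (simp add: inner_rotation_left[of v "rotation x"] inner_commute algebra_simps)
  then show ?thesis by simp
qed

locale trap_geodesic =
  fixes c c' :: "real \<Rightarrow> real^4"
  assumes in_ball: "norm (c t) \<le> 1"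
    and velocity: "(c has_vector_derivative c' t) (at t)"
    and acceleration: "(c' has_vector_derivative - \<Gamma> (c t) (c' t) (c' t)) (at t)"
begin

lemma c_derivative: "(c has_derivative (\<lambda>h. h *\<^sub>R c' t)) (at t)"
  using velocity by (simp add: has_vector_derivative_def)

lemma c'_derivative: "(c' has_derivative (\<lambda>h. h *\<^sub>R - \<Gamma> (c t) (c' t) (c' t))) (at t)"
  using acceleration unfolding has_vector_derivative_def .

lemma radial_derivative:
  "((\<lambda>t. c t \<bullet> c' t) has_real_derivative radial_hessian (c t) (c' t)) (at t)"
proof -
  have "((\<lambda>t. c t \<bullet> c' t) has_derivative
      (\<lambda>h. (c' t \<bullet> c' t - c t \<bullet> \<Gamma> (c t) (c' t) (c' t)) * h)) (at t)"
    by (rule has_derivative_eq_rhs[OF has_derivative_inner[OF c_derivative c'_derivative]])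
      (auto simp: algebra_simps inner_commute)
  then show ?thesis
    unfolding inner_\<Gamma>_radial[OF in_ball] by (simp add: has_field_derivative_def)
qed

text \<open>Noether conservation for the Killing field: the terms of the product rule are cancelled
  by the acceleration, by \<open>killing_momentum_\<Gamma>\<close>.\<close>

lemma killing_momentum_constant: "killing_momentum (c t) (c' t) = killing_momentum (c s) (c' s)"
proof -
  have "((\<lambda>t. killing_momentum (c t) (c' t)) has_real_derivative 0) (at t)" for t
  proof -
    let ?x = "c t" and ?v = "c' t"
    have rot: "((\<lambda>t. rotation (c t)) has_derivative (\<lambda>h. h *\<^sub>R rotation ?v)) (at t)"
      using bounded_linear.has_derivative[OF bounded_linear_rotation c_derivative]
      by (simp add: linear_cmul[OF linear_rotation])
    have "profile' ?x (h *\<^sub>R u) = h * profile' ?x u" for h u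
      by (simp add: profile'_def split_form_def linear_cmul[OF linear_rotation] algebra_simps)
    then have prof: "((\<lambda>t. profile (c t)) has_derivative (\<lambda>h. h * profile' ?x ?v)) (at t)"
      using has_derivative_compose[OF c_derivative[of t] has_derivative_profile[of "c t" UNIV]] by simp
    have "((\<lambda>t. killing_momentum (c t) (c' t)) has_derivative
        (\<lambda>h. (- killing_momentum ?x (\<Gamma> ?x ?v ?v) - (rotation ?x \<bullet> ?v) *
          (profile' ?x ?v * (rotation ?x \<bullet> rotation ?x) + 2 * profile ?x * (rotation ?x \<bullet> rotation ?v))) * h)) (at t)"
      unfolding killing_momentum_def
      by (rule has_derivative_eq_rhs[OF has_derivative_mult[OF has_derivative_inner[OF rot c'_derivative]
            has_derivative_diff[OF has_derivative_const has_derivative_mult[OF prof has_derivative_inner[OF rot rot]]]]])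
        (auto simp: algebra_simps inner_commute)
    moreover have "- killing_momentum ?x (\<Gamma> ?x ?v ?v) - (rotation ?x \<bullet> ?v) *
        (profile' ?x ?v * (rotation ?x \<bullet> rotation ?x) + 2 * profile ?x * (rotation ?x \<bullet> rotation ?v)) = 0"
      unfolding killing_momentum_\<Gamma>[OF in_ball] by (simp add: algebra_simps)
    ultimately show ?thesis
      by (simp only: has_field_derivative_def)
  qed
  then show ?thesis
    using DERIV_const_ratio_const[of t s] DERIV_isconst_all by blast
qed

end

section \<open>Absence of closed geodesics\<close>

lemma clifford_profile:
  assumes "rotation x \<bullet> rotation x = 1" "split_form x x = 0"
  shows "profile x = 2 / 3"
  using assms by (simp add: profile_def)

text \<open>The prime 2 has even multiplicity in \<open>m^2\<close> and odd multiplicity in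
  \<open>2 * n^2\<close>, unless both are zero. The integers will be winding numbers.\<close>

lemma sqrt_2_irrational:
  fixes m n :: int
  assumes "of_int m = sqrt 2 * of_int n"
  shows "n = 0"
proof -
  have "(of_int m)\<^sup>2 = 2 * (of_int n :: real)\<^sup>2" using assms by (simp add: power_mult_distrib)
  then have "(of_int (m^2)::real) = of_int (2 * n^2)" by simp
  then have eq: "m^2 = 2 * n^2" by (simp only: of_int_eq_iff)
  show ?thesis
  proof (rule ccontr)
    assume "n \<noteq> 0"
    with eq have "m \<noteq> 0" by auto
    have "multiplicity 2 (m^2) = multiplicity 2 (2 * n^2)" using eq by simp
    then have "2 * multiplicity 2 m = 1 + 2 * multiplicity 2 n"
      using \<open>n \<noteq> 0\<close> \<open>m \<noteq> 0\<close>
      by (simp add: prime_elem_multiplicity_power_distrib prime_elem_multiplicity_mult_distrib)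
    then show False by presburger
  qed
qed

text \<open>The complex function a + i b solves f' = i \<omega> f, so a return to a nonzero initial
  value forces exp (i \<omega> T) = 1.\<close>

lemma harmonic_rotation_period:
  fixes a b :: "real \<Rightarrow> real"
  assumes a: "\<And>t. (a has_real_derivative - \<omega> * b t) (at t)"
    and b: "\<And>t. (b has_real_derivative \<omega> * a t) (at t)"
    and per: "a T = a 0" "b T = b 0" and nz: "(a 0)\<^sup>2 + (b 0)\<^sup>2 \<noteq> 0"
  shows "cos (\<omega> * T) = 1"
proof -
  \<comment> \<open>Real and imaginary part of (a + i b) exp (- i \<omega> t), which is
    constant.\<close>
  define p where "p t = a t * cos (\<omega> * t) + b t * sin (\<omega> * t)" for t
  define q where "q t = b t * cos (\<omega> * t) - a t * sin (\<omega> * t)" for t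
  have "(p has_real_derivative 0) (at t)" for t
    unfolding p_def by (auto intro!: derivative_eq_intros a b simp: algebra_simps)
  then have p: "p T = p 0" using DERIV_isconst_all by blast
  have "(q has_real_derivative 0) (at t)" for t
    unfolding q_def by (auto intro!: derivative_eq_intros a b simp: algebra_simps)
  then have q: "q T = q 0" using DERIV_isconst_all by blast
  have "a 0 * p T + b 0 * q T = ((a 0)\<^sup>2 + (b 0)\<^sup>2) * cos (\<omega> * T)"
    unfolding p_def q_def per by (simp add: algebra_simps power2_eq_square)
  moreover have "a 0 * p 0 + b 0 * q 0 = (a 0)\<^sup>2 + (b 0)\<^sup>2"
    by (simp add: p_def q_def power2_eq_square)
  ultimately show ?thesis using nz p q by (metis mult_cancel_left2)
qed

lemma complete_geodesic_trap_metricD: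
  assumes "complete_geodesic (cball 0 1) trap_metric c"
  obtains c' where "trap_geodesic c c'"
  using assms unfolding complete_geodesic_def trap_geodesic_def by auto

lemma no_closed_geodesic: "\<not> closed_geodesic (cball 0 1) trap_metric c"
proof
  assume closed: "closed_geodesic (cball 0 1) trap_metric c"
  then obtain c' where "trap_geodesic c c'"
    unfolding closed_geodesic_def by (blast elim: complete_geodesic_trap_metricD)
  then interpret trap_geodesic c c' .
  obtain T where "T > 0" and per: "\<And>t. c (t + T) = c t"
    using closed unfolding closed_geodesic_def by blast
  have per': "c' (t + T) = c' t" for t
  proof -
    have "((\<lambda>t. t + T) has_derivative (\<lambda>h. h)) (at t)"
      by (auto intro!: derivative_eq_intros)
    from has_derivative_compose[of "\<lambda>t. t + T", OF this c_derivative]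
    have "((\<lambda>t. c (t + T)) has_vector_derivative c' (t + T)) (at t)"
      by (simp add: has_vector_derivative_def)
    then show ?thesis
      using velocity[of t] vector_derivative_unique_at per by auto
  qed
  \<comment> \<open>The function \<open>c t \<bullet> c' t\<close> is nondecreasing and periodic, so
    its derivative cannot be positive anywhere.\<close>
  have hess0: "radial_hessian (c t) (c' t) = 0" for t
  proof (rule ccontr)
    assume "radial_hessian (c t) (c' t) \<noteq> 0"
    then have "0 < radial_hessian (c t) (c' t)" using radial_hessian_nonneg[of "c t" "c' t"] by linarith
    from DERIV_pos_inc_right[OF radial_derivative this] obtain d
      where "d > 0" and d: "\<And>h. 0 < h \<Longrightarrow> h < d \<Longrightarrow> c t \<bullet> c' t < c (t + h) \<bullet> c' (t + h)" by blast
    \<comment> \<open>Below \<open>d\<close> there is a strict increase up to time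
      \<open>t + h\<close>; below \<open>T\<close> monotonicity carries it on to
      \<open>t + T\<close>.\<close>
    define h where "h = min (d / 2) T"
    have h: "0 < h" "h < d" "h \<le> T" using \<open>d > 0\<close> \<open>T > 0\<close> by (auto simp: h_def)
    have "c (t + h) \<bullet> c' (t + h) \<le> c (t + T) \<bullet> c' (t + T)"
      by (rule DERIV_nonneg_imp_nondecreasing[where f = "\<lambda>s. c s \<bullet> c' s"])
        (use h radial_derivative radial_hessian_nonneg in auto)
    also have "\<dots> = c t \<bullet> c' t" by (simp only: per per')
    finally show False using d[OF h(1,2)] by simp
  qed
  obtain t\<^sub>0 where "c' t\<^sub>0 \<noteq> 0"
  proof -
    have "\<exists>t. c' t \<noteq> 0"
    proof (rule ccontr)
      assume "\<nexists>t. c' t \<noteq> 0"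
      then have "(c has_derivative (\<lambda>h. 0)) (at t within UNIV)" for t
        using c_derivative[of t] by simp
      then have "c constant_on UNIV"
        unfolding constant_on_def using has_derivative_zero_constant[of UNIV c] by auto
      with closed show False by (simp add: closed_geodesic_def)
    qed
    with that show thesis by blast
  qed
  define M where "M = killing_momentum (c t\<^sub>0) (c' t\<^sub>0)"
  have M: "killing_momentum (c t) (c' t) = M" for t
    unfolding M_def by (rule killing_momentum_constant)
  \<comment> \<open>At \<open>t\<^sub>0\<close> the velocity is a nonzero multiple of
    \<open>rotation\<close>, and the factor 1 - \<psi> N equals 1/3 on the torus.\<close>
  have "M \<noteq> 0"
  proof
    assume "M = 0"
    note D = radial_hessian_eq_0D[OF hess0 \<open>c' t\<^sub>0 \<noteq> 0\<close>]
    have "rotation (c t\<^sub>0) \<bullet> c' t\<^sub>0 = 0"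
      using \<open>M = 0\<close> D(1) clifford_profile[OF D(1,2)] by (simp add: M_def killing_momentum_def)
    with D(3) \<open>c' t\<^sub>0 \<noteq> 0\<close> show False by simp
  qed
  \<comment> \<open>A nonzero momentum excludes zeros of the velocity, so the degenerate case of the
    Hessian holds at all times. The 3 is the inverse of 1 - \<psi> N = 1/3.\<close>
  have flow: "c' t = (3 * M) *\<^sub>R rotation (c t)"
    and torus: "(c t $ 1)\<^sup>2 + (c t $ 2)\<^sup>2 = 1/3" "(c t $ 3)\<^sup>2 + (c t $ 4)\<^sup>2 = 1/3" for t
  proof -
    have "c' t \<noteq> 0" using \<open>M \<noteq> 0\<close> M[of t] by (auto simp: killing_momentum_def)
    note D = radial_hessian_eq_0D[OF hess0 this]
    have "rotation (c t) \<bullet> c' t = 3 * M"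
      using M[of t] D(1) clifford_profile[OF D(1,2)] by (simp add: killing_momentum_def)
    with D(3) show "c' t = (3 * M) *\<^sub>R rotation (c t)" by simp
    from clifford_torus(1,2)[OF D(1,2)]
    show "(c t $ 1)\<^sup>2 + (c t $ 2)\<^sup>2 = 1/3" "(c t $ 3)\<^sup>2 + (c t $ 4)\<^sup>2 = 1/3" .
  qed
  have comp: "((\<lambda>t. c t $ i) has_real_derivative 3 * M * rotation (c t) $ i) (at t)" for i t
    using bounded_linear.has_vector_derivative[OF bounded_linear_vec_nth velocity, of i t]
    by (simp add: has_real_derivative_iff_has_vector_derivative flow)
  have "c T = c 0" using per[of 0] by simp
  have "cos (3 * M * T) = 1"
    by (rule harmonic_rotation_period[of "\<lambda>t. c t $ 1" _ "\<lambda>t. c t $ 2"])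
      (use comp[of 1] comp[of 2] torus(1)[of 0] \<open>c T = c 0\<close> in auto)
  moreover have "cos (3 * M * sqrt 2 * T) = 1"
    by (rule harmonic_rotation_period[of "\<lambda>t. c t $ 3" _ "\<lambda>t. c t $ 4"])
      (use comp[of 3] comp[of 4] torus(2)[of 0] \<open>c T = c 0\<close> in \<open>auto simp: mult.assoc\<close>)
  \<comment> \<open>The integers \<open>m\<close> and \<open>n\<close> count the turns in the two
    coordinate planes, whose frequencies have ratio \<open>sqrt 2\<close>.\<close>
  ultimately obtain m n :: int where m: "3 * M * T = of_int m * 2 * pi"
    and n: "3 * M * sqrt 2 * T = of_int n * 2 * pi"
    unfolding cos_one_2pi_int by blast
  have "of_int n * 2 * pi = sqrt 2 * (3 * M * T)" using n by (simp only: mult_ac)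
  also have "\<dots> = sqrt 2 * of_int m * 2 * pi" unfolding m by (simp only: mult.assoc)
  finally have "of_int n = sqrt 2 * of_int m" by simp
  then have "m = 0" by (rule sqrt_2_irrational)
  with m \<open>M \<noteq> 0\<close> \<open>T > 0\<close> show False by simp
qed

section \<open>The dense winding of the torus as a complete geodesic\<close>

definition winding :: "real \<Rightarrow> real^4" where
  "winding t = (1 / sqrt 3) *\<^sub>R vector [cos t, sin t, cos (sqrt 2 * t), sin (sqrt 2 * t)]"

lemma winding_component [simp]:
  "winding t $ 1 = cos t / sqrt 3" "winding t $ 2 = sin t / sqrt 3"
  "winding t $ 3 = cos (sqrt 2 * t) / sqrt 3" "winding t $ 4 = sin (sqrt 2 * t) / sqrt 3"
  by (simp_all add: winding_def vector_def)

lemma winding_torus: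
  "rotation (winding t) \<bullet> rotation (winding t) = 1" "split_form (winding t) (winding t) = 0"
  "winding t \<bullet> winding t = 2 / 3"
proof -
  have "(winding t $ 1)\<^sup>2 + (winding t $ 2)\<^sup>2 = 1/3" "(winding t $ 3)\<^sup>2 + (winding t $ 4)\<^sup>2 = 1/3"
    by (simp_all add: power_divide flip: add_divide_distrib)
  then show torus: "rotation (winding t) \<bullet> rotation (winding t) = 1" "split_form (winding t) (winding t) = 0"
    using clifford_torus_iff[of "winding t"] by blast+
  show "winding t \<bullet> winding t = 2 / 3" by (rule clifford_torus(3)[OF torus])
qed

lemma winding_derivative: "(winding has_vector_derivative rotation (winding t)) (at t)"
proof -
  have "((\<lambda>t. winding t $ i) has_real_derivative rotation (winding t) $ i) (at t)" for i
  proof -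
    have "\<forall>i. ((\<lambda>t. winding t $ i) has_real_derivative rotation (winding t) $ i) (at t)"
      unfolding forall_4 by (auto intro!: derivative_eq_intros simp: field_simps)
    then show ?thesis ..
  qed
  then have "((\<lambda>t. winding t $ i) has_derivative (\<lambda>h. h *\<^sub>R rotation (winding t) $ i)) (at t)" for i
    by (simp only: has_real_derivative_iff_has_vector_derivative has_vector_derivative_def)
  note component = this
  show ?thesis
    unfolding has_vector_derivative_def
  proof (rule has_derivative_componentwise_within[THEN iffD2], rule ballI)
    fix b :: "real^4"
    assume "b \<in> Basis"
    then obtain i where "b = axis i 1" by (auto simp: Basis_vec_def)
    with component[of i] show "((\<lambda>t. winding t \<bullet> b) has_derivative
        (\<lambda>h. h *\<^sub>R rotation (winding t) \<bullet> b)) (at t)"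
      by (simp add: inner_axis)
  qed
qed

lemma complete_geodesic_winding: "complete_geodesic (cball 0 1) trap_metric winding"
  unfolding complete_geodesic_def
proof (intro conjI allI exI[of _ "\<lambda>t. rotation (winding t)"])
  fix t
  let ?x = "winding t"
  have "(norm ?x)\<^sup>2 \<le> 1\<^sup>2" by (simp add: winding_torus flip: dot_square_norm)
  then have x: "norm ?x \<le> 1" by (rule power2_le_imp_le) simp
  then show "?x \<in> cball 0 1" by simp
  show "(winding has_vector_derivative rotation ?x) (at t)" by (rule winding_derivative)
  have "((\<lambda>t. rotation (winding t)) has_vector_derivative rotation (rotation ?x)) (at t)"
    by (rule bounded_linear.has_vector_derivative[OF bounded_linear_rotation winding_derivative])
  moreover have "rotation (rotation ?x) = - \<Gamma> ?x (rotation ?x) (rotation ?x)"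
  proof -
    let ?d = "rotation (rotation ?x) + \<Gamma> ?x (rotation ?x) (rotation ?x)"
    \<comment> \<open>By nondegeneracy the geodesic equation may be tested against every
      \<open>w\<close>.\<close>
    have "metric_form trap_metric ?x w ?d = 0" for w
    proof -
      have "2 * metric_form trap_metric ?x w ?d =
          2 * metric_form trap_metric ?x w (rotation (rotation ?x))
          + 2 * metric_form trap_metric ?x w (\<Gamma> ?x (rotation ?x) (rotation ?x))"
        by (simp add: metric_form_trap_metric inner_add_right algebra_simps)
      \<comment> \<open>With A the Euclidean product of \<open>w\<close> and
        \<open>rotation (rotation ?x)\<close>, the first term is 2 A. As \<psi> = 2/3 and \<psi>'(w)
        = 2/3 A on the torus, the Koszul term is - 4 \<psi> A + \<psi>'(w) = - 2 A.\<close>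
      also have "\<dots> = 0"
        unfolding metric_form_\<Gamma>[OF x] inner_trap_metric' metric_form_trap_metric[of ?x w "rotation (rotation ?x)"]
        by (simp add: winding_torus clifford_profile profile'_def[of _ w] inner_rotation_left[of w]
            inner_rotation_left[of "rotation ?x" w] inner_commute algebra_simps)
      finally show ?thesis by simp
    qed
    then have "?d = 0" using metric_form_trap_metric_pos[of ?d ?x] by force
    then show ?thesis by (simp add: eq_neg_iff_add_eq_0)
  qed
  ultimately show "((\<lambda>t. rotation (winding t)) has_vector_derivative
      - \<Gamma> ?x (rotation ?x) (rotation ?x)) (at t)" by simp
qed

lemma winding_nonconstant: "\<not> winding constant_on UNIV"
proof
  assume "winding constant_on UNIV"
  then obtain a where "winding t = a" for t unfolding constant_on_def by blast
  then have "winding 0 $ 1 = winding pi $ 1" by simp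
  then show False by simp
qed

theorem mainTheorem1:
  shows "\<exists>g :: real^4 \<Rightarrow> real^4^4.
    riemannian_metric_on (cball 0 1) g \<and>
    strictly_convex_boundary g \<and>
    (\<exists>c. complete_geodesic (cball 0 1) g c \<and> \<not> c constant_on UNIV) \<and>
    \<not> (\<exists>c. closed_geodesic (cball 0 1) g c)"
  using riemannian_metric_on_trap_metric strictly_convex_boundary_trap_metric
    complete_geodesic_winding winding_nonconstant no_closed_geodesic by blast

end
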